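(* Let $A\in\mathbb{C}^{n\times n}$, $\boldsymbol{B}\in\mathbb{C}^{n\times s}$ and $m\ge 1$. Let $\mathcal{K}^{\square}_m(A,\boldsymbol{B})$ be the block Krylov subspace equipped with the matrix-valued Euclidean inner product $\langle\!\langle\boldsymbol{X},\boldsymbol{Y}\rangle\!\rangle=\boldsymbol{X}^*\boldsymbol{Y}$, and let $\mathbb{P}^s_{m-1}$ be the space of $s\times s$ matrix polynomials of degree at most $m-1$ equipped with $\langle\!\langle\cdot,\cdot\rangle\!\rangle_{A,\boldsymbol{B}}$. Consider the linear mapping $$\mathcal{T}:\mathbb{P}^s_{m-1}\longrightarrow\mathcal{K}^{\square}_m(A,\boldsymbol{B}),\qquad \mathcal{T}(P)=P(A)\circ\boldsymbol{B}.$$ The following are equivalent: (1) no deflation occurs in $\mathcal{K}^{\square}_m(A,\boldsymbol{B})$ (i.e. $\mathcal{K}^{\square}_m(A,\boldsymbol{B})$ is nondeflating); (2) the mapping $\mathcal{T}$ is an isometric isomorphism; (3) the inner product $\langle\!\langle\cdot,\cdot\rangle\!\rangle_{A,\boldsymbol{B}}$ is nondegenerate over $\mathbb{P}^s_{m-1}$.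
   Context: A matrix polynomial is $P(z)=\sum_{k=0}^{d}z^kC_k$ with $C_k\in\mathbb{C}^{s\times s}$; its action is $P(A)\circ\boldsymbol{B}=\sum_{k=0}^{d}A^k\boldsymbol{B}C_k\in\mathbb{C}^{n\times s}$. The block Krylov subspace is $\mathcal{K}^{\square}_m(A,\boldsymbol{B})=\{\sum_{k=0}^{m-1}A^k\boldsymbol{B}C_k:\ C_k\in\mathbb{C}^{s\times s}\}\subseteq\mathbb{C}^{n\times s}$. The subspace $\mathcal{K}^{\square}_m(A,\boldsymbol{B})$ is called nondeflating ("no deflation occurs") if its dimension as a $\mathbb{C}$-vector space is $s^2m$; equivalently (a known fact), it admits an orthonormal basis of block vectors, i.e. there are $\boldsymbol{V}_1,\dots,\boldsymbol{V}_m\in\mathbb{C}^{n\times s}$ with $\boldsymbol{V}_i^*\boldsymbol{V}_j=\delta_{i,j}I_s$ and $\mathcal{K}^{\square}_m(A,\boldsymbol{B})=\{\sum_{k=1}^m\boldsymbol{V}_kC_k:\ C_k\in\mathbb{C}^{s\times s}\}$. The inner product induced by $(A,\boldsymbol{B})$ is $\langle\!\langle P,Q\rangle\!\rangle_{A,\boldsymbol{B}}=(P(A)\circ\boldsymbol{B})^*\,(Q(A)\circ\boldsymbol{B})\in\mathbb{C}^{s\times s}$. It is nondegenerate over $\mathbb{P}^s_{m-1}$ if $\langle\!\langle P,P\rangle\!\rangle_{A,\boldsymbol{B}}\neq 0$ for every $P\in\mathbb{P}^s_{m-1}$ with $P\not\equiv 0$. "Isometric isomorphism" means a $\mathbb{C}$-linear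 bijection with $\langle\!\langle P,Q\rangle\!\rangle_{A,\boldsymbol{B}}=\mathcal{T}(P)^*\mathcal{T}(Q)$ for all $P,Q\in\mathbb{P}^s_{m-1}$. *)

theory Defs
  imports "HOL-Analysis.Analysis" "HOL-Computational_Algebra.Polynomial"
begin

text \<open>
  An \<open>n \<times> s\<close> block vector has type \<^typ>\<open>complex^'s^'n\<close>.  The library's \<open>*s\<close> on this type
  takes a row vector as its scalar, hence the separate multiplication by a complex number.
\<close>

definition cscale :: "complex \<Rightarrow> complex^'b^'a \<Rightarrow> complex^'b^'a" where
  "cscale c X = map_matrix ((*) c) X"

interpretation cmat: vector_space "cscale :: complex \<Rightarrow> complex^'b^'a \<Rightarrow> complex^'b^'a"
  by unfold_locales (simp_all add: cscale_def vec_eq_iff algebra_simps)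

definition ctranspose :: "complex^'b^'a \<Rightarrow> complex^'a^'b" where
  "ctranspose X = transpose (map_matrix cnj X)"

definition block_inner :: "complex^'s^'n \<Rightarrow> complex^'s^'n \<Rightarrow> complex^'s^'s" where
  "block_inner X Y = ctranspose X ** Y"

text \<open>The power \<open>^\<close> on square matrices would be componentwise.\<close>

definition matpow :: "complex^'n^'n \<Rightarrow> nat \<Rightarrow> complex^'n^'n" where
  "matpow A k = (((**) A) ^^ k) (mat 1)"

text \<open>
  A matrix polynomial is represented by its coefficient sequence, an element of
  \<^typ>\<open>(complex^'s^'s) poly\<close>.  Only the additive structure of this type is used: its
  product, \<^const>\<open>smult\<close> and \<^const>\<open>poly\<close> rest on the componentwise product of matrices.
\<close>

definition matpoly_space :: "nat \<Rightarrow> (complex^'s^'s) poly set" where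
  "matpoly_space d = {P. degree P \<le> d}"

definition matpoly_scale :: "complex \<Rightarrow> (complex^'s^'s) poly \<Rightarrow> (complex^'s^'s) poly" where
  "matpoly_scale c P = map_poly (cscale c) P"

definition matpoly_act ::
    "complex^'n^'n \<Rightarrow> complex^'s^'n \<Rightarrow> (complex^'s^'s) poly \<Rightarrow> complex^'s^'n" where
  "matpoly_act A B P = (\<Sum>k\<le>degree P. matpow A k ** B ** coeff P k)"

definition block_krylov :: "nat \<Rightarrow> complex^'n^'n \<Rightarrow> complex^'s^'n \<Rightarrow> (complex^'s^'n) set" where
  "block_krylov m A B =
     {X. \<exists>C :: nat \<Rightarrow> complex^'s^'s. X = (\<Sum>k<m. matpow A k ** B ** C k)}"

definition nondeflating :: "nat \<Rightarrow> complex^'n^'n \<Rightarrow> complex^'s^'n \<Rightarrow> bool" where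
  "nondeflating m A B \<longleftrightarrow> cmat.dim (block_krylov m A B) = CARD('s)\<^sup>2 * m"

definition matpoly_inner ::
    "complex^'n^'n \<Rightarrow> complex^'s^'n \<Rightarrow> (complex^'s^'s) poly \<Rightarrow> (complex^'s^'s) poly \<Rightarrow> complex^'s^'s" where
  "matpoly_inner A B P Q = ctranspose (matpoly_act A B P) ** matpoly_act A B Q"

definition nondegenerate_on ::
    "(complex^'s^'s) poly set \<Rightarrow>
     ((complex^'s^'s) poly \<Rightarrow> (complex^'s^'s) poly \<Rightarrow> complex^'s^'s) \<Rightarrow> bool" where
  "nondegenerate_on S ip \<longleftrightarrow> (\<forall>P\<in>S. P \<noteq> 0 \<longrightarrow> ip P P \<noteq> 0)"

definition clinear_on ::
    "(complex^'s^'s) poly set \<Rightarrow> ((complex^'s^'s) poly \<Rightarrow> complex^'s^'n) \<Rightarrow> bool" where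
  "clinear_on S T \<longleftrightarrow>
     (\<forall>P\<in>S. \<forall>Q\<in>S. T (P + Q) = T P + T Q) \<and>
     (\<forall>c. \<forall>P\<in>S. T (matpoly_scale c P) = cscale c (T P))"

definition isometric_isomorphism ::
    "(complex^'s^'s) poly set \<Rightarrow>
     ((complex^'s^'s) poly \<Rightarrow> (complex^'s^'s) poly \<Rightarrow> complex^'s^'s) \<Rightarrow>
     (complex^'s^'n) set \<Rightarrow> (complex^'s^'n \<Rightarrow> complex^'s^'n \<Rightarrow> complex^'s^'s) \<Rightarrow>
     ((complex^'s^'s) poly \<Rightarrow> complex^'s^'n) \<Rightarrow> bool" where
  "isometric_isomorphism S ipS K ipK T \<longleftrightarrow>
     clinear_on S T \<and> bij_betw T S K \<and> (\<forall>P\<in>S. \<forall>Q\<in>S. ipS P Q = ipK (T P) (T Q))"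

end

theory Submission
  imports Defs
begin

text \<open>
  The map \<open>\<T>\<close> is always linear, onto the block Krylov space, and isometric by the definition of
  the polynomial inner product.  Hence (2) says that its kernel is trivial.  Since
  \<open>X\<^sup>* X = 0\<close> only for \<open>X = 0\<close>, so does (3).  Expanding the coefficients in matrix units shows that
  the Krylov space is spanned by the \<open>s\<^sup>2 m\<close> block vectors \<open>A\<^sup>k B E\<^sub>i\<^sub>j\<close>, whose linear relations
  are the elements of the kernel; so its dimension is \<open>s\<^sup>2 m\<close> iff the kernel is trivial.
\<close>

section \<open>Dimension of the span of a finite family\<close>

text \<open>A nontrivial relation makes one generator redundant, so fewer than \<open>card I\<close>
  vectors span; without relations the generators are distinct and independent. Counting indices
  instead of vectors makes a repeated generator count as a relation.\<close>

lemma (in vector_space) dim_span_image_eq_card_iff: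
  assumes "finite I"
  shows "dim (span (g ` I)) = card I \<longleftrightarrow>
         (\<forall>c. (\<Sum>i\<in>I. scale (c i) (g i)) = 0 \<longrightarrow> (\<forall>i\<in>I. c i = 0))"
    (is "?dim \<longleftrightarrow> ?indep")
proof
  assume dim: ?dim
  show ?indep
  proof (intro allI impI ballI, rule ccontr)
    fix c i assume rel: "(\<Sum>i\<in>I. scale (c i) (g i)) = 0" and i: "i \<in> I" "c i \<noteq> 0"
    let ?J = "I - {i}"
    have "scale (c i) (g i) = - (\<Sum>j\<in>?J. scale (c j) (g j))"
      using rel i assms by (simp add: sum.remove eq_neg_iff_add_eq_0)
    also have "\<dots> \<in> span (g ` ?J)"
      by (intro span_neg span_sum span_scale span_base) auto
    finally have "scale (inverse (c i)) (scale (c i) (g i)) \<in> span (g ` ?J)"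
      by (rule span_scale)
    then have gi: "g i \<in> span (g ` ?J)"
      using i by simp
    have "g ` I \<subseteq> span (g ` ?J)"
    proof
      fix x assume "x \<in> g ` I"
      then obtain j where "j \<in> I" "x = g j" by blast
      then show "x \<in> span (g ` ?J)"
        using gi by (cases "j = i") (auto intro: span_base)
    qed
    then have "span (g ` I) \<subseteq> span (g ` ?J)"
      by (simp add: span_minimal)
    then have "dim (span (g ` I)) \<le> card (g ` ?J)"
      using assms by (intro dim_le_card) auto
    also have "\<dots> \<le> card ?J"
      using assms by (intro card_image_le) auto
    also have "\<dots> < card I"
      using assms i by (intro card_Diff1_less)
    finally show False
      using dim by simp
  qed
next
  assume indep: ?indep
  have inj: "inj_on g I"
  proof (rule inj_onI, rule ccontr)
    fix i j assume ij: "i \<in> I" "j \<in> I" "g i = g j" "i \<noteq> j"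
    \<comment> \<open>The coefficients of the relation \<open>g i - g j = 0\<close> that two equal
      generators would give.\<close>
    define c :: "_ \<Rightarrow> 'a" where "c k = (if k = i then 1 else if k = j then - 1 else 0)" for k
    have "(\<Sum>k\<in>I. scale (c k) (g k)) = (\<Sum>k\<in>{i, j}. scale (c k) (g k))"
      using assms ij by (intro sum.mono_neutral_right) (auto simp: c_def)
    also have "\<dots> = 0"
      using ij by (simp add: c_def)
    finally have "c i = 0"
      using indep ij by blast
    then show False
      by (simp add: c_def)
  qed
  have "independent (g ` I)"
  proof
    assume "dependent (g ` I)"
    then obtain u where "\<exists>v\<in>g ` I. u v \<noteq> 0" "(\<Sum>v\<in>g ` I. scale (u v) v) = 0"
      using assms by (auto simp: dependent_finite)
    \<comment> \<open>By injectivity, a relation \<open>u\<close> over the image pulls back to the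
      relation \<open>u \<circ> g\<close> over \<open>I\<close>.\<close>
    then show False
      using indep[rule_format, of "u \<circ> g"] inj by (auto simp: sum.reindex)
  qed
  then have "dim (span (g ` I)) = card (g ` I)"
    by (rule dim_span_eq_card_independent)
  then show ?dim
    using inj by (simp add: card_image)
qed

section \<open>Matrix units and definiteness of the block inner product\<close>

lemma matrix_mul_sum_right:
  fixes M :: "'a::semiring_1^'n^'m"
  shows "M ** (\<Sum>i\<in>I. X i) = (\<Sum>i\<in>I. M ** X i)"
  by (induction I rule: infinite_finite_induct) (simp_all add: matrix_add_ldistrib)

lemma matrix_mul_cscale_right: "M ** cscale c X = cscale c (M ** X)"
  by (simp add: cscale_def matrix_matrix_mult_def vec_eq_iff sum_distrib_left mult_ac)

definition matrix_unit :: "'a \<Rightarrow> 'b \<Rightarrow> complex^'b^'a" where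
  "matrix_unit i j = (\<chi> p q. if p = i \<and> q = j then 1 else 0)"

lemma sum_matrix_unit:
  "(\<Sum>(i, j)\<in>UNIV. cscale (C $ i $ j) (matrix_unit i j)) = (C :: complex^'b^'a)"
proof -
  have "(\<Sum>(i, j)\<in>UNIV. C $ i $ j * (if p = i \<and> q = j then 1 else 0)) = C $ p $ q" for p q
  proof -
    have "(\<Sum>(i, j)\<in>UNIV. C $ i $ j * (if p = i \<and> q = j then 1 else 0)) =
          (\<Sum>x\<in>UNIV. if x = (p, q) then C $ fst x $ snd x else 0)"
      by (rule sum.cong) (auto split: if_splits)
    then show ?thesis by simp
  qed
  then show ?thesis
    by (simp add: vec_eq_iff cscale_def matrix_unit_def case_prod_beta)
qed

text \<open>The diagonal entries of \<open>X\<^sup>* X\<close> are the squared Euclidean norms of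
  the columns of \<open>X\<close>, so they already detect every nonzero entry.\<close>

lemma block_inner_self_eq_0_iff: "block_inner X X = 0 \<longleftrightarrow> X = 0"
proof
  assume eq: "block_inner X X = 0"
  show "X = 0"
  proof -
    have "X $ i $ j = 0" for i j
    proof -
      have "complex_of_real (\<Sum>k\<in>UNIV. (cmod (X $ k $ j))\<^sup>2) = block_inner X X $ j $ j"
        by (simp add: block_inner_def ctranspose_def matrix_matrix_mult_def transpose_def
            complex_norm_square mult.commute del: of_real_power)
      then have "(\<Sum>k\<in>UNIV. (cmod (X $ k $ j))\<^sup>2) = 0"
        using eq by (metis of_real_eq_0_iff zero_index)
      then show ?thesis
        by (subst (asm) sum_nonneg_eq_0_iff) auto
    qed
    then show ?thesis by (simp add: vec_eq_iff)
  qed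
qed (simp add: block_inner_def)

section \<open>Generators and dimension of the block Krylov space\<close>

text \<open>The linear map from coefficient families to block vectors. Families are total functions,
  but only their values below \<open>m\<close> enter; hence kernel statements are restricted to
  \<open>k < m\<close>.\<close>

definition krylov_sum :: "nat \<Rightarrow> complex^'n^'n \<Rightarrow> complex^'s^'n \<Rightarrow> (nat \<Rightarrow> complex^'s^'s) \<Rightarrow> complex^'s^'n"
  where "krylov_sum m A B C = (\<Sum>k<m. matpow A k ** B ** C k)"

lemma block_krylov_eq_range: "block_krylov m A B = range (krylov_sum m A B)"
  by (auto simp: block_krylov_def krylov_sum_def)

lemma krylov_sum_add:
  "krylov_sum m A B (\<lambda>k. C k + D k) = krylov_sum m A B C + krylov_sum m A B D"
  by (simp add: krylov_sum_def matrix_add_ldistrib sum.distrib)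

lemma krylov_sum_cscale:
  "krylov_sum m A B (\<lambda>k. cscale c (C k)) = cscale c (krylov_sum m A B C)"
  by (simp add: krylov_sum_def matrix_mul_cscale_right cmat.scale_sum_right)

lemma subspace_block_krylov: "cmat.subspace (block_krylov m A B)"
  unfolding block_krylov_eq_range
proof (rule cmat.subspaceI)
  have "krylov_sum m A B (\<lambda>_. 0) = 0"
    by (simp add: krylov_sum_def)
  then show "0 \<in> range (krylov_sum m A B)"
    by (metis rangeI)
qed (auto simp flip: krylov_sum_add krylov_sum_cscale)

lemma krylov_sum_expand:
  fixes B :: "complex^'s^'n"
  shows "krylov_sum m A B C =
    (\<Sum>(k, i, j)\<in>{..<m} \<times> UNIV. cscale (C k $ i $ j) (matpow A k ** B ** matrix_unit i j))"
proof -
  have "matpow A k ** B ** C k =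
        (\<Sum>(i, j)\<in>UNIV. cscale (C k $ i $ j) (matpow A k ** B ** matrix_unit i j))" for k
    by (subst sum_matrix_unit[of "C k", symmetric])
      (simp add: matrix_mul_sum_right matrix_mul_cscale_right case_prod_beta)
  then show ?thesis
    by (simp add: krylov_sum_def sum.cartesian_product)
qed

lemma block_krylov_eq_span:
  fixes B :: "complex^'s^'n"
  shows "block_krylov m A B =
    cmat.span ((\<lambda>(k, i, j). matpow A k ** B ** matrix_unit i j) ` ({..<m} \<times> UNIV))"
    (is "_ = cmat.span ?G")
proof
  have "matpow A k ** B ** matrix_unit i j \<in> ?G" if "k < m" for k i j
    using that by (intro image_eqI[where x = "(k, i, j)"]) auto
  then have "krylov_sum m A B C \<in> cmat.span ?G" for C
    unfolding krylov_sum_expand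
    by (intro cmat.span_sum) (auto simp: cmat.span_scale cmat.span_base)
  then show "block_krylov m A B \<subseteq> cmat.span ?G"
    by (auto simp: block_krylov_eq_range)
next
  show "cmat.span ?G \<subseteq> block_krylov m A B"
  proof (rule cmat.span_minimal)
    show "?G \<subseteq> block_krylov m A B"
    proof
      fix X assume "X \<in> ?G"
      then obtain k i j where k: "k < m" and X: "X = matpow A k ** B ** matrix_unit i j"
        by auto
      \<comment> \<open>A generator comes from the family concentrated at the single index
        \<open>k\<close>.\<close>
      have "X = krylov_sum m A B (\<lambda>l. if l = k then matrix_unit i j else 0)"
        using k by (simp add: X krylov_sum_def if_distrib cong: if_cong)
      then show "X \<in> block_krylov m A B"
        by (simp add: block_krylov_eq_range)
    qed
  qed (rule subspace_block_krylov)
qed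

text \<open>The generators are indexed by \<open>m\<close> powers and \<open>s\<^sup>2\<close>
  matrix units, so nondeflation says that this family has no nontrivial relation. A scalar family on
  the triples \<open>(k, i, j)\<close> is the same data as the matrices \<open>C k\<close> for
  \<open>k < m\<close>.\<close>

lemma nondeflating_iff:
  fixes B :: "complex^'s^'n"
  shows "nondeflating m A B \<longleftrightarrow> (\<forall>C. krylov_sum m A B C = 0 \<longrightarrow> (\<forall>k<m. C k = 0))"
proof -
  let ?I = "{..<m} \<times> (UNIV :: ('s \<times> 's) set)"
  let ?g = "\<lambda>(k, i, j). matpow A k ** B ** matrix_unit i j"
  have "CARD('s)\<^sup>2 * m = card ?I"
    by (simp add: card_cartesian_product power2_eq_square flip: UNIV_Times_UNIV)
  then have "nondeflating m A B \<longleftrightarrow>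
      (\<forall>c. (\<Sum>x\<in>?I. cscale (c x) (?g x)) = 0 \<longrightarrow> (\<forall>x\<in>?I. c x = 0))"
    unfolding nondeflating_def block_krylov_eq_span
    by (simp only: cmat.dim_span_image_eq_card_iff finite_cartesian_product finite_lessThan finite)
  also have "\<dots> \<longleftrightarrow> (\<forall>C. krylov_sum m A B C = 0 \<longrightarrow> (\<forall>k<m. C k = 0))"
  proof (intro iffI allI impI ballI)
    fix C :: "nat \<Rightarrow> complex^'s^'s" and k
    assume h: "\<forall>c. (\<Sum>x\<in>?I. cscale (c x) (?g x)) = 0 \<longrightarrow> (\<forall>x\<in>?I. c x = 0)"
      and C: "krylov_sum m A B C = 0" and k: "k < m"
    show "C k = 0"
      using h[rule_format, of "\<lambda>(k, i, j). C k $ i $ j"] C k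
      by (force simp: krylov_sum_expand vec_eq_iff case_prod_beta)
  next
    fix c x
    assume h: "\<forall>C. krylov_sum m A B C = 0 \<longrightarrow> (\<forall>k<m. C k = 0)"
      and c: "(\<Sum>x\<in>?I. cscale (c x) (?g x)) = 0" and x: "x \<in> ?I"
    define C :: "nat \<Rightarrow> complex^'s^'s" where "C k = (\<chi> i j. c (k, i, j))" for k
    obtain k i j where k: "x = (k, i, j)" "k < m"
      using x by auto
    have "krylov_sum m A B C = 0"
      using c by (simp add: krylov_sum_expand C_def case_prod_beta)
    then have "C k $ i $ j = 0"
      using h k by (metis zero_index)
    then show "c x = 0"
      by (simp add: C_def k)
  qed
  finally show ?thesis .
qed

section \<open>Matrix polynomials and the map they induce\<close>

text \<open>Padding with zero coefficients replaces the summation bound \<open>degree P\<close> by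
  one common to all polynomials of the space, as additivity requires.\<close>

lemma matpoly_act_eq_krylov_sum:
  assumes "degree P < m"
  shows "matpoly_act A B P = krylov_sum m A B (coeff P)"
  unfolding matpoly_act_def krylov_sum_def
  using assms by (intro sum.mono_neutral_left) (auto simp: coeff_eq_0)

text \<open>For \<open>m = 0\<close> truncated subtraction would leave the constants on the left and
  nothing on the right.\<close>

lemma matpoly_space_eq: "m \<ge> 1 \<Longrightarrow> matpoly_space (m - 1) = {P. degree P < m}"
  by (auto simp: matpoly_space_def)

lemma ex_matpoly_coeff:
  fixes C :: "nat \<Rightarrow> complex^'s^'s"
  assumes "m \<ge> 1"
  obtains P where "P \<in> matpoly_space (m - 1)" "\<And>k. k < m \<Longrightarrow> coeff P k = C k"
proof
  \<comment> \<open>Coefficients beyond the list default to 0; trailing zeros in \<open>C\<close>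
    may make the degree smaller than \<open>m - 1\<close>.\<close>
  let ?P = "Poly (map C [0..<m])"
  have "degree ?P \<le> m - 1"
    by (rule degree_le) (auto simp: coeff_Poly_eq nth_default_def)
  then show "?P \<in> matpoly_space (m - 1)"
    by (simp add: matpoly_space_def)
  show "coeff ?P k = C k" if "k < m" for k
    using that by (simp add: nth_default_def)
qed

text \<open>Serves both to compare the two kernels and to show surjectivity onto the Krylov
  space.\<close>

lemma krylov_sum_eq_matpoly_act:
  fixes C :: "nat \<Rightarrow> complex^'s^'s"
  assumes "m \<ge> 1"
  obtains P where "P \<in> matpoly_space (m - 1)" "\<And>k. k < m \<Longrightarrow> coeff P k = C k"
    "matpoly_act A B P = krylov_sum m A B C"
proof -
  obtain P where P: "P \<in> matpoly_space (m - 1)" "\<And>k. k < m \<Longrightarrow> coeff P k = C k"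
    using ex_matpoly_coeff[OF assms] by blast
  then have "matpoly_act A B P = krylov_sum m A B (coeff P)"
    using matpoly_space_eq[OF assms] by (intro matpoly_act_eq_krylov_sum) auto
  also have "\<dots> = krylov_sum m A B C"
    using P by (simp add: krylov_sum_def)
  finally show thesis
    using P that by blast
qed

lemma matpoly_act_kernel_iff:
  assumes "m \<ge> 1"
  shows "(\<forall>P\<in>matpoly_space (m - 1). matpoly_act A B P = 0 \<longrightarrow> P = 0) \<longleftrightarrow>
         (\<forall>C. krylov_sum m A B C = 0 \<longrightarrow> (\<forall>k<m. C k = 0))"
proof safe
  fix C k
  assume h: "\<forall>P\<in>matpoly_space (m - 1). matpoly_act A B P = 0 \<longrightarrow> P = 0"
    and C: "krylov_sum m A B C = 0" and k: "k < m"
  obtain P where P: "P \<in> matpoly_space (m - 1)" "\<And>k. k < m \<Longrightarrow> coeff P k = C k"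
    "matpoly_act A B P = krylov_sum m A B C"
    using krylov_sum_eq_matpoly_act[OF assms] by blast
  then have "P = 0"
    using h C by metis
  then show "C k = 0"
    using P(2)[OF k] by simp
next
  fix P
  assume h: "\<forall>C. krylov_sum m A B C = 0 \<longrightarrow> (\<forall>k<m. C k = 0)"
    and P: "P \<in> matpoly_space (m - 1)" "matpoly_act A B P = 0"
  have deg: "degree P < m"
    using P matpoly_space_eq[OF assms] by blast
  then have "krylov_sum m A B (coeff P) = 0"
    using P by (simp add: matpoly_act_eq_krylov_sum)
  \<comment> \<open>The leading coefficient is among those with index below \<open>m\<close>, and
    its vanishing already forces \<open>P = 0\<close>.\<close>
  then have "coeff P (degree P) = 0"
    using h deg by blast
  then show "P = 0" by simp
qed

lemma clinear_on_matpoly_act: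
  fixes B :: "complex^'s^'n"
  assumes "m \<ge> 1"
  shows "clinear_on (matpoly_space (m - 1)) (matpoly_act A B)"
  unfolding clinear_on_def matpoly_space_eq[OF assms]
proof safe
  fix P Q :: "(complex^'s^'s) poly" assume "degree P < m" "degree Q < m"
  then show "matpoly_act A B (P + Q) = matpoly_act A B P + matpoly_act A B Q"
    by (simp add: matpoly_act_eq_krylov_sum[of _ m] degree_add_less plus_poly.rep_eq
        krylov_sum_add)
next
  fix c and P :: "(complex^'s^'s) poly" assume P: "degree P < m"
  \<comment> \<open>Scaling by \<open>c = 0\<close> can lower the degree, so only the bound is
    carried over.\<close>
  have "degree (matpoly_scale c P) < m"
    using P map_poly_degree_leq[of "cscale c" P] by (simp add: matpoly_scale_def)
  moreover have "coeff (matpoly_scale c P) = (\<lambda>k. cscale c (coeff P k))"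
    by (simp add: matpoly_scale_def coeff_map_poly fun_eq_iff)
  ultimately show "matpoly_act A B (matpoly_scale c P) = cscale c (matpoly_act A B P)"
    using P by (simp add: matpoly_act_eq_krylov_sum[of _ m] krylov_sum_cscale)
qed

lemma matpoly_act_image:
  assumes "m \<ge> 1"
  shows "matpoly_act A B ` matpoly_space (m - 1) = block_krylov m A B"
proof
  show "matpoly_act A B ` matpoly_space (m - 1) \<subseteq> block_krylov m A B"
    unfolding block_krylov_eq_range matpoly_space_eq[OF assms]
    by (auto simp: matpoly_act_eq_krylov_sum)
next
  show "block_krylov m A B \<subseteq> matpoly_act A B ` matpoly_space (m - 1)"
  proof
    fix X assume "X \<in> block_krylov m A B"
    then obtain C where X: "X = krylov_sum m A B C"
      unfolding block_krylov_eq_range by blast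
    obtain P where "P \<in> matpoly_space (m - 1)" "matpoly_act A B P = krylov_sum m A B C"
      using krylov_sum_eq_matpoly_act[OF assms] by blast
    then show "X \<in> matpoly_act A B ` matpoly_space (m - 1)"
      using X by (metis imageI)
  qed
qed

lemma inj_on_matpoly_act_iff:
  assumes "m \<ge> 1"
  shows "inj_on (matpoly_act A B) (matpoly_space (m - 1)) \<longleftrightarrow>
         (\<forall>P\<in>matpoly_space (m - 1). matpoly_act A B P = 0 \<longrightarrow> P = 0)" (is "?inj \<longleftrightarrow> ?ker")
proof
  assume inj: ?inj
  have "0 \<in> matpoly_space (m - 1)" "matpoly_act A B 0 = 0"
    by (simp_all add: matpoly_space_def matpoly_act_def)
  then show ?ker
    using inj by (metis inj_onD)
next
  assume ker: ?ker
  show ?inj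
  proof (rule inj_onI)
    fix P Q assume PQ: "P \<in> matpoly_space (m - 1)" "Q \<in> matpoly_space (m - 1)"
      and eq: "matpoly_act A B P = matpoly_act A B Q"
    have D: "P - Q \<in> matpoly_space (m - 1)"
      using PQ by (auto simp: matpoly_space_def intro: degree_diff_le)
    \<comment> \<open>\<open>clinear_on\<close> speaks of sums and not of differences, so additivity
      is applied to \<open>(P - Q) + Q\<close>.\<close>
    have "matpoly_act A B ((P - Q) + Q) = matpoly_act A B (P - Q) + matpoly_act A B Q"
      using clinear_on_matpoly_act[OF assms, of A B] D PQ unfolding clinear_on_def by blast
    then have "matpoly_act A B (P - Q) = 0"
      using eq by simp
    then show "P = Q"
      using ker D by (metis eq_iff_diff_eq_0)
  qed
qed

theorem theorem3p2:
  fixes A :: "complex^'n^'n" and B :: "complex^'s^'n" and m :: nat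
  assumes "m \<ge> 1"
  shows "(nondeflating m A B \<longleftrightarrow>
            isometric_isomorphism (matpoly_space (m - 1)) (matpoly_inner A B)
              (block_krylov m A B) block_inner (matpoly_act A B)) \<and>
         (isometric_isomorphism (matpoly_space (m - 1)) (matpoly_inner A B)
              (block_krylov m A B) block_inner (matpoly_act A B) \<longleftrightarrow>
            nondegenerate_on (matpoly_space (m - 1)) (matpoly_inner A B))"
proof -
  let ?ker = "\<forall>P\<in>matpoly_space (m - 1). matpoly_act A B P = 0 \<longrightarrow> P = 0"
  have inner: "matpoly_inner A B P Q = block_inner (matpoly_act A B P) (matpoly_act A B Q)" for P Q
    by (simp add: matpoly_inner_def block_inner_def)
  have "nondeflating m A B \<longleftrightarrow> ?ker"
    unfolding nondeflating_iff matpoly_act_kernel_iff[OF assms] ..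
  moreover have "isometric_isomorphism (matpoly_space (m - 1)) (matpoly_inner A B)
      (block_krylov m A B) block_inner (matpoly_act A B) \<longleftrightarrow> ?ker"
    \<comment> \<open>Linearity, surjectivity and isometry hold unconditionally; what remains is
      injectivity.\<close>
    unfolding isometric_isomorphism_def bij_betw_def
    using clinear_on_matpoly_act[OF assms, of A B] matpoly_act_image[OF assms, of A B]
      inj_on_matpoly_act_iff[OF assms, of A B] inner by auto
  moreover have "nondegenerate_on (matpoly_space (m - 1)) (matpoly_inner A B) \<longleftrightarrow> ?ker"
    by (auto simp: nondegenerate_on_def inner block_inner_self_eq_0_iff)
  ultimately show ?thesis by blast
qed

end
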